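(* Let $N_t$ be the self-exciting point process with rate function $\lambda$ and initial condition $\gamma>0$. Assume that $\lim_{z\to\infty}\frac{\lambda(z)}{z}=\alpha\in(0,\infty)$. Then, for any fixed $t>0$, $$\lim_{\ell\to\infty}\frac1\ell\log\mathbb{P}(N_t\ge\ell)=\log\left(1-\frac{1}{(t+1)^{\alpha}}\right).$$
   Context: Model: $\lambda:\mathbb{R}_{\ge 0}\to\mathbb{R}_{\ge 0}$ and $\gamma> 0$ are given; $N_t$ is a simple point process on $(0,\infty)$ with $N_0=0$ (empty past history) whose intensity at time $t$ with respect to its natural filtration is $\lambda_t=\lambda\left(\frac{N_{t-}+\gamma}{t+1}\right)$. Standing assumptions: $\lambda$ is (strictly) increasing and continuously differentiable; the equation $x=\lambda(x)$ has finitely many solutions, and each solution $x^*$ satisfies either $\lambda'(x^* )<1$ or $\lambda'(x^* )>1$. *)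

theory Defs
  imports "HOL-Probability.Probability"
begin

(* The left limit f(t-) of a counting path.  It exists for every t > 0 when f is monotone on
   [0, \<infinity>), because f is then bounded and hence eventually constant to the left of t. *)
definition left_lim :: "(real \<Rightarrow> nat) \<Rightarrow> real \<Rightarrow> nat" where
  "left_lim f t = Lim (at_left t) f"

(* Counting function t \<mapsto> #(points in (0, t]) of a locally finite set of points of (0, \<infinity>):
   local finiteness is expressed by the value type nat, simplicity by the unit jumps.
   Values at negative arguments play no role. *)
definition simple_counting_path :: "(real \<Rightarrow> nat) \<Rightarrow> bool" where
  "simple_counting_path f \<longleftrightarrow>
     f 0 = 0 \<and>
     mono_on {0..} f \<and>
     (\<forall>t\<ge>0. continuous (at_right t) f) \<and>
     (\<forall>t>0. f t \<le> left_lim f t + 1)"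

definition jump_times :: "(real \<Rightarrow> nat) \<Rightarrow> real set" where
  "jump_times f = {t. 0 < t \<and> f t \<noteq> left_lim f t}"

definition simple_point_process :: "'a measure \<Rightarrow> (real \<Rightarrow> 'a \<Rightarrow> nat) \<Rightarrow> bool" where
  "simple_point_process M N \<longleftrightarrow>
     (\<forall>t\<ge>0. N t \<in> measurable M (count_space UNIV)) \<and>
     (\<forall>\<omega>\<in>space M. simple_counting_path (\<lambda>t. N t \<omega>))"

definition natural_filtration :: "'a measure \<Rightarrow> (real \<Rightarrow> 'a \<Rightarrow> nat) \<Rightarrow> real \<Rightarrow> 'a measure" where
  "natural_filtration M N t =
     sigma (space M) {N s -` A \<inter> space M | s A. 0 \<le> s \<and> s \<le> t}"

(* Processes are indexed by the time set (0, \<infinity>). *)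
definition predictable_sigma :: "'a measure \<Rightarrow> (real \<Rightarrow> 'a measure) \<Rightarrow> (real \<times> 'a) measure" where
  "predictable_sigma M F =
     sigma ({0<..} \<times> space M)
       {{a<..b} \<times> A | a b A. 0 \<le> a \<and> a \<le> b \<and> A \<in> sets (F a)}"

definition progressive :: "(real \<Rightarrow> 'a measure) \<Rightarrow> (real \<Rightarrow> 'a \<Rightarrow> real) \<Rightarrow> bool" where
  "progressive F X \<longleftrightarrow>
     (\<forall>t>0. (\<lambda>(s, \<omega>). X s \<omega>) \<in> borel_measurable (restrict_space borel {0<..t} \<Otimes>\<^sub>M F t))"

(* Bremaud's definition of a stochastic intensity: for every nonnegative predictable C,
   E[\<integral> C dN] = E[\<integral> C X ds].  As the jumps of N have size one, \<integral> C dN is the sum of C over the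
   jump times.  Testing with all predictable C, rather than only with the conditional means of
   N over deterministic intervals, keeps the definition meaningful without assuming that N
   has finite mean. *)
definition has_intensity ::
    "'a measure \<Rightarrow> (real \<Rightarrow> 'a measure) \<Rightarrow> (real \<Rightarrow> 'a \<Rightarrow> nat) \<Rightarrow> (real \<Rightarrow> 'a \<Rightarrow> real) \<Rightarrow> bool" where
  "has_intensity M F N X \<longleftrightarrow>
     (\<forall>t>0. \<forall>\<omega>\<in>space M. 0 \<le> X t \<omega>) \<and>
     progressive F X \<and>
     (AE \<omega> in M. \<forall>t>0. (\<integral>\<^sup>+ s\<in>{0<..t}. ennreal (X s \<omega>) \<partial>lborel) < \<infinity>) \<and>
     (\<forall>C :: real \<times> 'a \<Rightarrow> ennreal. C \<in> borel_measurable (predictable_sigma M F) \<longrightarrow>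
        (\<integral>\<^sup>+ \<omega>. (\<integral>\<^sup>+ s. C (s, \<omega>) \<partial>count_space (jump_times (\<lambda>t. N t \<omega>))) \<partial>M) =
        (\<integral>\<^sup>+ \<omega>. (\<integral>\<^sup>+ s\<in>{0<..}. C (s, \<omega>) * ennreal (X s \<omega>) \<partial>lborel) \<partial>M))"

definition self_exciting_point_process ::
    "'a measure \<Rightarrow> (real \<Rightarrow> real) \<Rightarrow> real \<Rightarrow> (real \<Rightarrow> 'a \<Rightarrow> nat) \<Rightarrow> bool" where
  "self_exciting_point_process M lam \<gamma> N \<longleftrightarrow>
     prob_space M \<and>
     simple_point_process M N \<and>
     has_intensity M (natural_filtration M N) N
       (\<lambda>t \<omega>. lam ((real (left_lim (\<lambda>s. N s \<omega>) t) + \<gamma>) / (t + 1)))"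

(* Derivatives are taken within [0, \<infinity>), hence one-sided at 0: the rate function is only
   given there, and its values at negative arguments are irrelevant. *)
definition admissible_rate :: "(real \<Rightarrow> real) \<Rightarrow> bool" where
  "admissible_rate lam \<longleftrightarrow>
     (\<forall>x\<ge>0. 0 \<le> lam x) \<and>
     strict_mono_on {0..} lam \<and>
     finite {x. 0 \<le> x \<and> x = lam x} \<and>
     (\<exists>lam'. (\<forall>x\<ge>0. (lam has_real_derivative lam' x) (at x within {0..})) \<and>
             continuous_on {0..} lam' \<and>
             (\<forall>x\<ge>0. x = lam x \<longrightarrow> lam' x < 1 \<or> lam' x > 1))"

end

theory Submission
  imports Defs
begin

text \<open>
  Let \<open>Q n s = P(N\<^sub>s \<ge> n)\<close>. Testing the intensity against the predictable indicator of
  \<open>{s \<le> t, N\<^sub>s\<^sub>- = n}\<close> counts the at most one jump from \<open>n\<close> to \<open>n + 1\<close> before \<open>t\<close> and yields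
  \<open>Q (n + 1)' = r n s * (Q n - Q (n + 1))\<close> with \<open>r n s = \<lambda> ((n + \<gamma>) / (s + 1))\<close>. On \<open>[0, t]\<close> these
  rates are eventually squeezed between \<open>a * n / (s + 1)\<close> for \<open>a\<close> slightly below and slightly above
  \<open>\<alpha>\<close>, the rates of a Yule process in the time \<open>ln (s + 1)\<close>, whose tails are the geometric sequences
  \<open>(1 - c * (s + 1) powr (- a)) ^ n\<close>. Comparing \<open>Q\<close> with such sequences from a large level on gives
  both bounds; \<open>c\<close> is slightly smaller than \<open>1\<close> for the upper bound and slightly larger for the lower
  one, which absorbs the finitely many levels where the rates are not controlled.
\<close>

subsection \<open>Counting paths\<close>

text \<open>On \<open>[0, t)\<close> a monotone path is bounded by \<open>f t\<close>, so it takes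
  finitely many values there; from the point where the largest one is attained on, it is
  constant.\<close>

lemma left_lim_attained:
  assumes f: "simple_counting_path f" and t: "0 < t"
  obtains u where "0 \<le> u" "u < t" "\<And>s. u \<le> s \<Longrightarrow> s < t \<Longrightarrow> f s = left_lim f t"
proof -
  have mono: "mono_on {0..} f"
    using f by (simp add: simple_counting_path_def)
  have bound: "f ` {0..<t} \<subseteq> {..f t}"
    using mono t by (auto simp: mono_on_def)
  then have fin: "finite (f ` {0..<t})"
    by (rule finite_subset) simp
  have ne: "f ` {0..<t} \<noteq> {}"
    using t by auto
  define m where "m = Max (f ` {0..<t})"
  have "m \<in> f ` {0..<t}"
    unfolding m_def using fin ne by (rule Max_in)
  then obtain u where u: "0 \<le> u" "u < t" "f u = m"
    by auto
  have const: "f s = m" if "u \<le> s" "s < t" for s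
  proof (rule antisym)
    show "f s \<le> m"
      unfolding m_def using fin that u by (intro Max_ge) auto
    show "m \<le> f s"
      using mono u that by (auto simp: mono_on_def)
  qed
  have "eventually (\<lambda>s. s \<in> {u<..<t}) (at_left t)"
    using u(2) by (rule eventually_at_left_real)
  then have "eventually (\<lambda>s. f s = m) (at_left t)"
    by eventually_elim (auto intro: const)
  then have "(f \<longlongrightarrow> m) (at_left t)"
    by (rule tendsto_eventually)
  then have "left_lim f t = m"
    unfolding left_lim_def by (intro tendsto_Lim) (simp_all add: trivial_limit_at_left_real)
  then show thesis
    using const u by (intro that[of u]) auto
qed

text \<open>Restricting to rational times turns events about the left limit into countable unions,
  which is how they become measurable and predictable.\<close>

lemma le_left_lim_iff:
  assumes f: "simple_counting_path f" and t: "0 < t"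
  shows "k \<le> left_lim f t \<longleftrightarrow> (\<exists>q\<in>\<rat>. 0 \<le> q \<and> q < t \<and> k \<le> f q)"
proof -
  have mono: "mono_on {0..} f"
    using f by (simp add: simple_counting_path_def)
  obtain u where u: "0 \<le> u" "u < t" "\<And>s. u \<le> s \<Longrightarrow> s < t \<Longrightarrow> f s = left_lim f t"
    using left_lim_attained[OF f t] by blast
  obtain q where q: "q \<in> \<rat>" "u < q" "q < t"
    using Rats_dense_in_real u(2) by blast
  show ?thesis
  proof
    assume "k \<le> left_lim f t"
    then show "\<exists>q\<in>\<rat>. 0 \<le> q \<and> q < t \<and> k \<le> f q"
      using q u by (intro bexI[of _ q]) auto
  next
    assume "\<exists>q\<in>\<rat>. 0 \<le> q \<and> q < t \<and> k \<le> f q"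
    then obtain p where p: "0 \<le> p" "p < t" "k \<le> f p"
      by blast
    have "f p \<le> f (max p u)"
      by (rule mono_onD[OF mono]) (use p u(1,2) in simp_all)
    moreover have "f (max p u) = left_lim f t"
      by (rule u(3)) (use p u(1,2) in simp_all)
    ultimately show "k \<le> left_lim f t"
      using p(3) by linarith
  qed
qed

lemma le_left_lim:
  assumes f: "simple_counting_path f" and "0 \<le> s" "s < t"
  shows "f s \<le> left_lim f t"
proof -
  have mono: "mono_on {0..} f"
    using f by (simp add: simple_counting_path_def)
  have t: "0 < t"
    using assms by simp
  obtain q where q: "q \<in> \<rat>" "s < q" "q < t"
    using Rats_dense_in_real assms(3) by blast
  have "f s \<le> f q"
    using mono assms q by (auto simp: mono_on_def)
  then show ?thesis
    unfolding le_left_lim_iff[OF f t] using q assms by (intro bexI[of _ q]) auto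
qed

lemma left_lim_le:
  assumes f: "simple_counting_path f" and t: "0 < t"
  shows "left_lim f t \<le> f t"
proof -
  have mono: "mono_on {0..} f"
    using f by (simp add: simple_counting_path_def)
  obtain q where q: "0 \<le> q" "q < t" "left_lim f t \<le> f q"
    using le_left_lim_iff[OF f t, of "left_lim f t"] by auto
  have "f q \<le> f t"
    using mono q by (auto simp: mono_on_def)
  with q(3) show ?thesis
    by simp
qed

text \<open>The jump sits at the first passage time above \<open>n\<close>: before it the path is at
  most \<open>n\<close>, right continuity puts it above \<open>n\<close> at that time, and the unit
  jump then forces the left limit to be \<open>n\<close> itself.\<close>

lemma ex_jump_from_level:
  assumes f: "simple_counting_path f" and t: "0 \<le> t" and n: "n < f t"
  shows "\<exists>s\<in>jump_times f. s \<le> t \<and> left_lim f s = n"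
proof -
  have mono: "mono_on {0..} f" and f0: "f 0 = 0"
    and rc: "\<And>s. 0 \<le> s \<Longrightarrow> continuous (at_right s) f"
    and jump: "\<And>s. 0 < s \<Longrightarrow> f s \<le> left_lim f s + 1"
    using f by (auto simp: simple_counting_path_def)
  define S where "S = {u. 0 \<le> u \<and> n < f u}"
  define s where "s = Inf S"
  have tS: "t \<in> S" and bdd: "bdd_below S"
    using t n by (auto simp: S_def intro: bdd_belowI[of _ 0])
  have s0: "0 \<le> s"
    unfolding s_def using tS by (intro cInf_greatest) (auto simp: S_def)
  have st: "s \<le> t"
    unfolding s_def using tS bdd by (rule cInf_lower)
  have below: "f u \<le> n" if "0 \<le> u" "u < s" for u
  proof (rule ccontr)
    assume "\<not> f u \<le> n"
    then have "u \<in> S"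
      using that by (simp add: S_def)
    then show False
      using cInf_lower[OF _ bdd, of u] that by (simp add: s_def)
  qed
  have above: "n < f u" if u: "s < u" for u
  proof -
    obtain v where "v \<in> S" "v < u"
      using u cInf_less_iff[of S u] tS bdd by (auto simp: s_def)
    then show ?thesis
      using mono by (auto simp: S_def mono_on_def intro: less_le_trans)
  qed
  have "eventually (\<lambda>u. f u = f s) (at_right s)"
    using rc[OF s0] by (simp add: continuous_within tendsto_discrete)
  moreover have "eventually (\<lambda>u. u \<in> {s<..<s + 1}) (at_right s)"
    by (rule eventually_at_right_real) simp
  ultimately have "eventually (\<lambda>u. n < f s) (at_right s)"
    by eventually_elim (metis above greaterThanLessThan_iff)
  then have fs: "n < f s"
    by (simp add: trivial_limit_at_right_real)
  then have spos: "0 < s"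
    using s0 f0 by (cases "s = 0") auto
  have "left_lim f s \<le> n"
  proof (rule ccontr)
    assume "\<not> left_lim f s \<le> n"
    then have "Suc n \<le> left_lim f s"
      by simp
    then show False
      unfolding le_left_lim_iff[OF f spos] using below by (meson not_less_eq_eq)
  qed
  with jump[OF spos] fs have "left_lim f s = n"
    by simp
  with fs spos st show ?thesis
    by (auto simp: jump_times_def)
qed

text \<open>A jump from \<open>n\<close> leaves every later left limit above \<open>n\<close>, so
  there is at most one; it occurs by time \<open>t\<close> exactly when the path has passed
  \<open>n\<close>.\<close>

lemma emeasure_jumps_from_level:
  assumes f: "simple_counting_path f" and t: "0 \<le> t"
  shows "emeasure (count_space (jump_times f)) {s \<in> jump_times f. s \<le> t \<and> left_lim f s = n} =
    (if n < f t then 1 else 0)"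
proof -
  define S where "S = {s \<in> jump_times f. s \<le> t \<and> left_lim f s = n}"
  have mono: "mono_on {0..} f"
    using f by (simp add: simple_counting_path_def)
  have S: "0 < s" "s \<le> t" "left_lim f s = n" "n < f s" if "s \<in> S" for s
    using that left_lim_le[OF f, of s] by (auto simp: S_def jump_times_def)
  have "emeasure (count_space (jump_times f)) S = (if n < f t then 1 else 0)"
  proof (cases "n < f t")
    case True
    then obtain s where s: "s \<in> S"
      using ex_jump_from_level[OF f t] by (auto simp: S_def)
    have not_less: "\<not> p < q" if "p \<in> S" "q \<in> S" for p q
      using le_left_lim[OF f, of p q] S[OF that(1)] S[OF that(2)] by linarith
    have "p = s" if "p \<in> S" for p
      using not_less[OF that s] not_less[OF s that] by linarith
    with s have "S = {s}"
      by blast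
    moreover have "s \<in> jump_times f"
      using s by (simp add: S_def)
    ultimately show ?thesis
      using True by simp
  next
    case False
    have "s \<notin> S" for s
    proof
      assume s: "s \<in> S"
      have "f s \<le> f t"
        by (rule mono_onD[OF mono]) (use S[OF s] t in simp_all)
      then show False
        using S(4)[OF s] False by linarith
    qed
    then have "S = {}"
      by blast
    then show ?thesis
      using False by simp
  qed
  then show ?thesis
    by (simp only: S_def)
qed

subsection \<open>Comparison for the forward equations\<close>

text \<open>Integrating factor: \<open>D s * exp (integral {a..s} r)\<close> has nonnegative
  derivative.\<close>

lemma nonneg_of_deriv_ge:
  fixes D D' r :: "real \<Rightarrow> real"
  assumes ab: "a \<le> b" and r: "continuous_on {a..b} r"
    and D: "\<And>s. s \<in> {a..b} \<Longrightarrow> (D has_real_derivative D' s) (at s within {a..b})"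
    and ge: "\<And>s. s \<in> {a..b} \<Longrightarrow> - r s * D s \<le> D' s"
    and Da: "0 \<le> D a"
  shows "0 \<le> D b"
proof -
  define E where "E s = D s * exp (integral {a..s} r)" for s
  have E: "(E has_real_derivative (D' s + r s * D s) * exp (integral {a..s} r)) (at s within {a..b})"
    if "s \<in> {a..b}" for s
    unfolding E_def using that
    by (auto intro!: derivative_eq_intros D integral_has_real_derivative r simp: algebra_simps)
  have "E a \<le> E b"
  proof (rule DERIV_nonneg_imp_increasing_open[OF ab])
    fix s assume s: "a < s" "s < b"
    then have "0 \<le> (D' s + r s * D s) * exp (integral {a..s} r)"
      using ge[of s] by (intro mult_nonneg_nonneg) auto
    moreover have "(E has_real_derivative (D' s + r s * D s) * exp (integral {a..s} r)) (at s)"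
      using E[of s] s by (simp add: at_within_Icc_at)
    ultimately show "\<exists>y. (E has_real_derivative y) (at s) \<and> 0 \<le> y"
      by blast
  next
    show "continuous_on {a..b} E"
      using E by (rule DERIV_continuous_on)
  qed
  moreover have "0 \<le> E a"
    using Da by (simp add: E_def)
  ultimately have "0 \<le> D b * exp (integral {a..b} r)"
    by (simp add: E_def)
  then show ?thesis
    by (simp add: zero_le_mult_iff)
qed

text \<open>\<open>Q n s\<close> plays the role of the probability that a pure birth process with rates \<open>r n s\<close>,
  started in \<open>0\<close>, has reached \<open>n\<close> by time \<open>s\<close>.\<close>

locale birth_tails =
  fixes Q r :: "nat \<Rightarrow> real \<Rightarrow> real"
  assumes Q_0: "0 \<le> s \<Longrightarrow> Q 0 s = 1"
    and Q_Suc_start: "Q (Suc n) 0 = 0"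
    and Q_nonneg: "0 \<le> Q n s"
    and Q_le_1: "Q n s \<le> 1"
    and Q_mono: "0 \<le> s \<Longrightarrow> s \<le> s' \<Longrightarrow> Q n s \<le> Q n s'"
    and r_pos: "0 \<le> s \<Longrightarrow> 0 < r n s"
    and r_cont: "continuous_on {0..} (r n)"
    and Q_deriv: "0 \<le> s \<Longrightarrow>
      (Q (Suc n) has_real_derivative r n s * (Q n s - Q (Suc n) s)) (at s within {0..})"
begin

lemma Q_deriv_Icc:
  assumes "0 \<le> a" "s \<in> {a..b}"
  shows "(Q (Suc n) has_real_derivative r n s * (Q n s - Q (Suc n) s)) (at s within {a..b})"
  using assms by (intro DERIV_subset[OF Q_deriv]) auto

lemma r_cont_Icc: "0 \<le> a \<Longrightarrow> continuous_on {a..b} (r n)"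
  by (rule continuous_on_subset[OF r_cont]) auto

text \<open>Induction on the level: if \<open>Q (Suc n)\<close> vanished at \<open>s\<close>, it
  would vanish on \<open>[0, s]\<close>, yet its derivative at \<open>s / 2\<close> would be
  \<open>r n (s / 2) * Q n (s / 2) > 0\<close>. Positivity is what later allows logarithms to be
  compared.\<close>

lemma Q_pos: "0 < s \<Longrightarrow> 0 < Q n s"
proof (induction n arbitrary: s)
  case 0
  then show ?case
    by (simp add: Q_0)
next
  case (Suc n)
  show ?case
  proof (rule ccontr)
    assume "\<not> 0 < Q (Suc n) s"
    then have zero: "Q (Suc n) u = 0" if "0 \<le> u" "u \<le> s" for u
      using Q_mono[OF that, of "Suc n"] Q_nonneg[of "Suc n" u] by simp
    have mid: "0 < s / 2" "s / 2 < s"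
      using Suc.prems by auto
    have "(Q (Suc n) has_real_derivative r n (s / 2) * (Q n (s / 2) - Q (Suc n) (s / 2))) (at (s / 2))"
      using Q_deriv_Icc[of 0 "s / 2" s n] mid by (simp add: at_within_Icc_at)
    then have "((\<lambda>_. 0) has_real_derivative r n (s / 2) * Q n (s / 2)) (at (s / 2))"
      using mid zero
      by (auto intro!: has_field_derivative_transform_within_open[of "Q (Suc n)" _ _ "{0<..<s}"])
    then have "r n (s / 2) * Q n (s / 2) = 0"
      using DERIV_unique DERIV_const by blast
    then show False
      using r_pos[of "s / 2" n] Suc.IH[OF mid(1)] mid by simp
  qed
qed

text \<open>For every \<open>c\<close>, the function \<open>x = 1 - c * (s + 1) powr (- a)\<close>
  solves \<open>x' = a * (1 - x) / (s + 1)\<close>, so its powers solve the forward equations with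
  the Yule rates \<open>a * (n + 1) / (s + 1)\<close>. Different \<open>c\<close> give the two
  comparison functions.\<close>

lemma has_derivative_one_minus_powr:
  assumes "- 1 < s"
  shows "((\<lambda>s. 1 - c * (s + 1) powr (- a)) has_real_derivative
    a * (c * (s + 1) powr (- a)) / (s + 1)) (at s within A)"
proof -
  have "((\<lambda>s. (s + 1) powr (- a)) has_real_derivative - a * (s + 1) powr (- a - 1) * 1) (at s within A)"
    using assms by (intro DERIV_fun_powr derivative_eq_intros) auto
  then have "((\<lambda>s. 1 - c * (s + 1) powr (- a)) has_real_derivative
      0 - c * (- a * (s + 1) powr (- a - 1) * 1)) (at s within A)"
    by (intro DERIV_diff DERIV_const DERIV_cmult)
  moreover have "(s + 1) powr (- a - 1) = (s + 1) powr (- a) / (s + 1)"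
    using assms by (subst powr_diff) simp
  ultimately show ?thesis
    by (simp add: mult_ac)
qed

text \<open>The supersolution is a geometric tail started from \<open>\<eta>\<close> rather than \<open>0\<close>: the factor
  \<open>\<eta> ^ n0\<close> then makes it dominate \<open>1\<close> at the level \<open>n0\<close> from which the rate bound holds.\<close>

lemma Q_upper:
  assumes a: "0 < a" and eta: "0 < \<eta>" "\<eta> < 1"
    and rate: "\<And>n s. n0 \<le> n \<Longrightarrow> 0 \<le> s \<Longrightarrow> s \<le> T \<Longrightarrow> r n s \<le> a * (real n + 1) / (s + 1)"
    and "n0 \<le> n" "0 \<le> s" "s \<le> T"
  shows "Q n s \<le> (1 - (1 - \<eta>) * (s + 1) powr (- a)) ^ n / \<eta> ^ n0"
proof -
  define x where "x s = 1 - (1 - \<eta>) * (s + 1) powr (- a)" for s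
  have x_ge: "\<eta> \<le> x s" if "0 \<le> s" for s
  proof -
    have "(s + 1) powr (- a) \<le> 1"
      using that a powr_mono[of "- a" 0 "s + 1"] by simp
    then have "(1 - \<eta>) * (s + 1) powr (- a) \<le> 1 - \<eta>"
      using eta by (intro mult_left_le) auto
    then show ?thesis
      by (simp add: x_def)
  qed
  have x_le: "x s \<le> 1" for s
    using eta by (simp add: x_def)
  have x': "(x has_real_derivative a * (1 - x s) / (s + 1)) (at s within A)" if "0 \<le> s" for s A
    unfolding x_def using has_derivative_one_minus_powr[of s "1 - \<eta>" a A] that by simp
  have "Q (n0 + k) s \<le> x s ^ (n0 + k) / \<eta> ^ n0" if "0 \<le> s" "s \<le> T" for k s
    using that
  proof (induction k arbitrary: s)
    case 0
    have "\<eta> ^ n0 \<le> x s ^ n0"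
      using x_ge[OF 0(1)] eta by (intro power_mono) auto
    then have "1 \<le> x s ^ n0 / \<eta> ^ n0"
      using eta by simp
    then show ?case
      using Q_le_1[of n0 s] by simp
  next
    case (Suc k)
    define m where "m = n0 + k"
    define D where "D u = x u ^ Suc m / \<eta> ^ n0 - Q (Suc m) u" for u
    \<comment> \<open>The first term is the derivative of \<open>x u ^ Suc m / \<eta> ^ n0\<close>,
      written as the Yule rate at \<open>m\<close> times the difference of two consecutive
      powers.\<close>
    define D' where "D' u = (a * (real m + 1) / (u + 1)) * (x u ^ m * (1 - x u)) / \<eta> ^ n0
      - r m u * (Q m u - Q (Suc m) u)" for u
    have "0 \<le> D s"
    proof (rule nonneg_of_deriv_ge[where D = D and b = s and a = 0 and r = "r m" and D' = D'])
      show "0 \<le> s"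
        by fact
      show "continuous_on {0..s} (r m)"
        by (rule r_cont_Icc) simp
      show "(D has_real_derivative D' u) (at u within {0..s})" if "u \<in> {0..s}" for u
      proof -
        have x'u: "(x has_real_derivative a * (1 - x u) / (u + 1)) (at u within {0..s})"
          using that by (intro x') simp
        have "(D has_real_derivative
            real (Suc m) * (a * (1 - x u) / (u + 1) * x u ^ (Suc m - Suc 0)) / \<eta> ^ n0
            - r m u * (Q m u - Q (Suc m) u)) (at u within {0..s})"
          unfolding D_def
          by (intro DERIV_diff DERIV_cdivide DERIV_power x'u Q_deriv_Icc that order_refl)
        then show ?thesis
          by (simp add: D'_def mult_ac add_ac)
      qed
      \<comment> \<open>\<open>D' u + r m u * D u\<close> is the rate gap times
        \<open>x u ^ m * (1 - x u) / \<eta> ^ n0\<close> plus \<open>r m u\<close> times the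
        difference at level \<open>m\<close>, which is nonnegative by induction.\<close>
      show "- r m u * D u \<le> D' u" if u: "u \<in> {0..s}" for u
      proof -
        have pos: "0 \<le> x u ^ m * (1 - x u) / \<eta> ^ n0"
          using x_ge[of u] x_le[of u] u eta by auto
        have "r m u \<le> a * (real m + 1) / (u + 1)"
          using rate[of m u] u Suc.prems by (simp add: m_def)
        then have "r m u * (x u ^ m * (1 - x u) / \<eta> ^ n0)
            \<le> a * (real m + 1) / (u + 1) * (x u ^ m * (1 - x u) / \<eta> ^ n0)"
          using pos by (rule mult_right_mono)
        moreover have "r m u * Q m u \<le> r m u * (x u ^ m / \<eta> ^ n0)"
          using Suc.IH[of u] u Suc.prems r_pos[of u m] by (intro mult_left_mono) (auto simp: m_def)
        ultimately show ?thesis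
          unfolding D_def D'_def by (simp add: algebra_simps diff_divide_distrib)
      qed
      show "0 \<le> D 0"
        using x_ge[of 0] eta by (simp add: D_def Q_Suc_start)
    qed
    then show ?case
      by (simp add: D_def m_def)
  qed
  from this[of s "n - n0"] assms show ?thesis
    by (simp add: x_def)
qed

text \<open>The subsolution is a Yule process restarted at time \<open>d\<close> from level
  \<open>n0\<close>, weighted with the mass \<open>Q n0 d\<close> that has arrived there by then. A
  start at time \<open>0\<close> would give nothing, since \<open>Q n0 0 = 0\<close> for
  \<open>n0 > 0\<close>.\<close>

lemma Q_lower:
  assumes a: "0 < a" and d: "0 < d"
    and rate: "\<And>k s. d \<le> s \<Longrightarrow> s \<le> T \<Longrightarrow> a * (real k + 1) / (s + 1) \<le> r (n0 + k) s"
    and "d \<le> s" "s \<le> T"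
  shows "Q n0 d * (1 - ((d + 1) / (s + 1)) powr a) ^ k \<le> Q (n0 + k) s"
proof -
  define y where "y s = 1 - ((d + 1) / (s + 1)) powr a" for s
  have y0: "y d = 0"
    using d by (simp add: y_def)
  have y_le: "y s \<le> 1" for s
    by (simp add: y_def)
  have y_ge: "0 \<le> y s" if "d \<le> s" for s
    using that d a powr_mono2[of a "(d + 1) / (s + 1)" 1] by (simp add: y_def)
  have y': "(y has_real_derivative a * (1 - y s) / (s + 1)) (at s within A)" if "d \<le> s" for s A
  proof -
    \<comment> \<open>Here \<open>c = (d + 1) powr a\<close>, chosen so that \<open>y\<close>
      vanishes at \<open>d\<close>; the two forms of \<open>y\<close> agree only for arguments above
      \<open>- 1\<close>, hence the passage through an open set.\<close>
    have "((\<lambda>s. 1 - (d + 1) powr a * (s + 1) powr (- a)) has_real_derivative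
        a * (1 - y s) / (s + 1)) (at s)"
      using has_derivative_one_minus_powr[of s "(d + 1) powr a" a UNIV] that d
      by (simp add: y_def powr_divide powr_minus_divide)
    moreover have "1 - (d + 1) powr a * (v + 1) powr (- a) = y v" if "- 1 < v" for v
      using that d by (simp add: y_def powr_divide powr_minus_divide)
    ultimately have "(y has_real_derivative a * (1 - y s) / (s + 1)) (at s)"
      using that d
      by (elim has_field_derivative_transform_within_open[where S = "{- 1<..}"]) auto
    then show ?thesis
      by (rule has_field_derivative_at_within)
  qed
  have "Q n0 d * y s ^ k \<le> Q (n0 + k) s" if "d \<le> s" "s \<le> T" for k s
    using that
  proof (induction k arbitrary: s)
    case 0
    then show ?case
      using Q_mono[of d s n0] d by simp
  next
    case (Suc k)
    define m where "m = n0 + k"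
    define q where "q = Q n0 d"
    have q: "0 \<le> q"
      by (simp add: q_def Q_nonneg)
    define D where "D u = Q (Suc m) u - q * y u ^ Suc k" for u
    define D' where "D' u = r m u * (Q m u - Q (Suc m) u)
      - (a * (real k + 1) / (u + 1)) * (q * (y u ^ k * (1 - y u)))" for u
    have "0 \<le> D s"
    proof (rule nonneg_of_deriv_ge[where D = D and b = s and a = d and r = "r m" and D' = D'])
      show "d \<le> s"
        by fact
      show "continuous_on {d..s} (r m)"
        using d by (intro r_cont_Icc) simp
      show "(D has_real_derivative D' u) (at u within {d..s})" if "u \<in> {d..s}" for u
      proof -
        have y'u: "(y has_real_derivative a * (1 - y u) / (u + 1)) (at u within {d..s})"
          using that by (intro y') simp
        have "(D has_real_derivative r m u * (Q m u - Q (Suc m) u)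
            - q * (real (Suc k) * (a * (1 - y u) / (u + 1) * y u ^ (Suc k - Suc 0))))
            (at u within {d..s})"
          unfolding D_def using d
          by (intro DERIV_diff DERIV_cmult DERIV_power y'u Q_deriv_Icc that) simp
        then show ?thesis
          by (simp add: D'_def mult_ac add_ac)
      qed
      show "- r m u * D u \<le> D' u" if u: "u \<in> {d..s}" for u
      proof -
        have pos: "0 \<le> q * (y u ^ k * (1 - y u))"
          using y_ge[of u] y_le[of u] u q by auto
        have "a * (real k + 1) / (u + 1) \<le> r m u"
          using rate[of u k] u Suc.prems by (simp add: m_def)
        then have "a * (real k + 1) / (u + 1) * (q * (y u ^ k * (1 - y u)))
            \<le> r m u * (q * (y u ^ k * (1 - y u)))"
          using pos by (rule mult_right_mono)
        moreover have "r m u * (q * y u ^ k) \<le> r m u * Q m u"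
          using Suc.IH[of u] u d Suc.prems r_pos[of u m]
          by (intro mult_left_mono) (auto simp: m_def q_def)
        ultimately show ?thesis
          unfolding D_def D'_def by (simp add: algebra_simps)
      qed
      show "0 \<le> D d"
        by (simp add: D_def y0 Q_nonneg)
    qed
    then show ?case
      by (simp add: D_def m_def q_def)
  qed
  then show ?thesis
    using assms by (simp add: y_def)
qed

end

subsection \<open>Forward equations for the tail probabilities\<close>

locale self_exciting =
  fixes M :: "'a measure" and N :: "real \<Rightarrow> 'a \<Rightarrow> nat" and lam :: "real \<Rightarrow> real" and \<gamma> :: real
  assumes gamma_pos: "0 < \<gamma>"
    and lam_admissible: "admissible_rate lam"
    and process: "self_exciting_point_process M lam \<gamma> N"

sublocale self_exciting \<subseteq> prob_space M
  using process by (simp add: self_exciting_point_process_def)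

context self_exciting
begin

definition level_rate :: "nat \<Rightarrow> real \<Rightarrow> real" where
  "level_rate n s = lam ((real n + \<gamma>) / (s + 1))"

definition tail :: "nat \<Rightarrow> real \<Rightarrow> real" where
  "tail k s = measure M {\<omega> \<in> space M. k \<le> N s \<omega>}"

text \<open>The intensity sees the left limit of the path, so the integral equation first appears
  with these probabilities on its right-hand side.\<close>

definition left_tail :: "nat \<Rightarrow> real \<Rightarrow> real" where
  "left_tail k s = measure M {\<omega> \<in> space M. k \<le> left_lim (\<lambda>u. N u \<omega>) s}"

definition reached_before :: "nat \<Rightarrow> (real \<times> 'a) set" where
  "reached_before k = {(s, \<omega>). 0 < s \<and> \<omega> \<in> space M \<and> k \<le> left_lim (\<lambda>u. N u \<omega>) s}"

section \<open>Measurable level sets, elementary facts on the rates, and predictability\<close>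

lemma path: "\<omega> \<in> space M \<Longrightarrow> simple_counting_path (\<lambda>u. N u \<omega>)"
  using process by (simp add: self_exciting_point_process_def simple_point_process_def)

lemma N_measurable: "0 \<le> s \<Longrightarrow> N s \<in> measurable M (count_space UNIV)"
  using process by (simp add: self_exciting_point_process_def simple_point_process_def)

lemma level_set_eq: "{\<omega> \<in> space M. k \<le> N s \<omega>} = N s -` {k..} \<inter> space M"
  by auto

lemma sets_level: "0 \<le> s \<Longrightarrow> {\<omega> \<in> space M. k \<le> N s \<omega>} \<in> sets M"
  unfolding level_set_eq by (intro measurable_sets[OF N_measurable]) auto

lemma sets_level_filtration:
  assumes "0 \<le> s"
  shows "{\<omega> \<in> space M. k \<le> N s \<omega>} \<in> sets (natural_filtration M N s)"
  unfolding natural_filtration_def level_set_eq using assms by (intro in_measure_of) auto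

lemma lam_less: "0 \<le> x \<Longrightarrow> x < y \<Longrightarrow> lam x < lam y"
  using lam_admissible by (auto simp: admissible_rate_def strict_mono_on_def)

lemma lam_pos: "0 < x \<Longrightarrow> 0 < lam x"
  using lam_less[of 0 x] lam_admissible by (auto simp: admissible_rate_def intro: le_less_trans)

lemma lam_cont: "continuous_on {0..} lam"
  using lam_admissible by (auto simp: admissible_rate_def intro: DERIV_continuous_on)

lemma level_rate_pos: "0 \<le> s \<Longrightarrow> 0 < level_rate n s"
  using gamma_pos by (simp add: level_rate_def lam_pos add_nonneg_pos)

lemma level_rate_cont: "continuous_on {0..} (level_rate n)"
  unfolding level_rate_def using gamma_pos
  by (intro continuous_on_compose2[OF lam_cont] continuous_intros) auto

lemma level_rate_le:
  assumes "0 \<le> s"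
  shows "level_rate n s \<le> level_rate n 0"
proof -
  have "(real n + \<gamma>) / (s + 1) \<le> real n + \<gamma>"
    using assms gamma_pos by (simp add: divide_le_eq mult_le_cancel_left1)
  then show ?thesis
    using lam_less[of "(real n + \<gamma>) / (s + 1)" "real n + \<gamma>"] assms gamma_pos
    by (cases "(real n + \<gamma>) / (s + 1) = real n + \<gamma>") (auto simp: level_rate_def)
qed

text \<open>Each piece is a generator of the predictable sigma-algebra, as
  \<open>k \<le> N q \<omega>\<close> is decided at time \<open>q\<close>. Generators have bounded
  time intervals, whence the union over \<open>m\<close>; \<open>max\<close> keeps the right end
  from falling below \<open>q\<close>.\<close>

lemma reached_before_eq:
  "reached_before k = (\<Union>q\<in>\<rat> \<inter> {0..}. \<Union>m::nat. {q<..max q (real m)} \<times> {\<omega> \<in> space M. k \<le> N q \<omega>})"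
    (is "_ = ?R")
proof (intro set_eqI iffI)
  fix p assume "p \<in> reached_before k"
  then obtain s \<omega> where p: "p = (s, \<omega>)" "0 < s" "\<omega> \<in> space M" "k \<le> left_lim (\<lambda>u. N u \<omega>) s"
    by (auto simp: reached_before_def)
  then obtain q where q: "q \<in> \<rat>" "0 \<le> q" "q < s" "k \<le> N q \<omega>"
    using le_left_lim_iff[OF path] by blast
  obtain m :: nat where "s \<le> real m"
    using real_arch_simple by blast
  then have "p \<in> {q<..max q (real m)} \<times> {\<omega> \<in> space M. k \<le> N q \<omega>}"
    using p q by auto
  then show "p \<in> ?R"
    using q by blast
next
  fix p assume "p \<in> ?R"
  then obtain q m where q: "q \<in> \<rat>" "0 \<le> q"
      and "p \<in> {q<..max q (real m)} \<times> {\<omega> \<in> space M. k \<le> N q \<omega>}"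
    by blast
  then obtain s \<omega> where p: "p = (s, \<omega>)" "q < s" "\<omega> \<in> space M" "k \<le> N q \<omega>"
    by auto
  moreover have "k \<le> left_lim (\<lambda>u. N u \<omega>) s"
    using le_left_lim_iff[OF path[OF p(3)], of s k] p q by auto
  ultimately show "p \<in> reached_before k"
    using q by (simp add: reached_before_def)
qed

lemma countable_Rats_nonneg: "countable (\<rat> \<inter> {0::real..})"
  by (intro countable_Int1 countable_rat)

lemma predictable_rectangle:
  assumes "0 \<le> a" "a \<le> b" "A \<in> sets (natural_filtration M N a)"
  shows "{a<..b} \<times> A \<in> sets (predictable_sigma M (natural_filtration M N))"
  unfolding predictable_sigma_def
proof (rule in_measure_of)
  have "A \<subseteq> space M" if "A \<in> sets (natural_filtration M N a)" for a A
    using sets.sets_into_space[OF that] by (simp add: natural_filtration_def space_measure_of_conv)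
  then show "{{a<..b} \<times> A |a b A. 0 \<le> a \<and> a \<le> b \<and> A \<in> sets (natural_filtration M N a)}
      \<subseteq> Pow ({0<..} \<times> space M)"
    by fastforce
qed (use assms in auto)

lemma predictable_reached_before:
  "reached_before k \<in> sets (predictable_sigma M (natural_filtration M N))"
  unfolding reached_before_eq
  by (intro sets.countable_UN' countable_Rats_nonneg sets.countable_UN predictable_rectangle
      sets_level_filtration image_subsetI) auto

lemma sets_reached_before: "reached_before k \<in> sets (lborel \<Otimes>\<^sub>M M)"
  unfolding reached_before_eq
  by (intro sets.countable_UN' countable_Rats_nonneg sets.countable_UN pair_measureI
      sets_level image_subsetI) auto

lemma reached_before_section:
  "0 < s \<Longrightarrow> Pair s -` reached_before k = {\<omega> \<in> space M. k \<le> left_lim (\<lambda>u. N u \<omega>) s}"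
  by (auto simp: reached_before_def)

lemma sets_left_level: "0 < s \<Longrightarrow> {\<omega> \<in> space M. k \<le> left_lim (\<lambda>u. N u \<omega>) s} \<in> sets M"
  using sets_Pair1[OF sets_reached_before, of s k] by (simp add: reached_before_section)

section \<open>From the intensity identity to an integral equation\<close>

lemma nn_integral_intensity:
  assumes C: "C \<in> borel_measurable (predictable_sigma M (natural_filtration M N))"
  shows "(\<integral>\<^sup>+ \<omega>. (\<integral>\<^sup>+ s. C (s, \<omega>) \<partial>count_space (jump_times (\<lambda>t. N t \<omega>))) \<partial>M) =
    (\<integral>\<^sup>+ \<omega>. (\<integral>\<^sup>+ s\<in>{0<..}. C (s, \<omega>) *
      ennreal (lam ((real (left_lim (\<lambda>s. N s \<omega>) s) + \<gamma>) / (s + 1))) \<partial>lborel) \<partial>M)"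
  using process C unfolding self_exciting_point_process_def has_intensity_def by blast

text \<open>The test function is the indicator of \<open>B\<close>, where the left limit is
  \<open>n\<close> and the time at most \<open>t\<close>. One side counts jumps from
  \<open>n\<close>; on the other the rate is deterministic on \<open>B\<close>, and exchanging the
  integrals leaves the probability that the left limit is \<open>n\<close>.\<close>

lemma ennreal_tail_Suc:
  assumes t: "0 \<le> t"
  shows "ennreal (tail (Suc n) t) =
    (\<integral>\<^sup>+ s. ennreal (level_rate n s * (left_tail n s - left_tail (Suc n) s)) * indicator {0<..t} s \<partial>lborel)"
proof -
  define B where "B = (reached_before n - reached_before (Suc n)) \<inter> ({0<..t} \<times> space M)"
  have B_iff: "(s, \<omega>) \<in> B \<longleftrightarrow> 0 < s \<and> s \<le> t \<and> left_lim (\<lambda>u. N u \<omega>) s = n" if "\<omega> \<in> space M" for s \<omega>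
    using that by (auto simp: B_def reached_before_def)
  have B_pred: "B \<in> sets (predictable_sigma M (natural_filtration M N))"
    unfolding B_def
    by (intro sets.Int sets.Diff predictable_reached_before predictable_rectangle)
      (use t in \<open>auto simp: natural_filtration_def\<close>)
  have B_prod: "B \<in> sets (lborel \<Otimes>\<^sub>M M)"
    unfolding B_def by (intro sets.Int sets.Diff sets_reached_before pair_measureI) auto
  define C where "C = (indicator B :: real \<times> 'a \<Rightarrow> ennreal)"
  have "(\<integral>\<^sup>+ \<omega>. (\<integral>\<^sup>+ s. C (s, \<omega>) \<partial>count_space (jump_times (\<lambda>t. N t \<omega>))) \<partial>M) =
      (\<integral>\<^sup>+ \<omega>. indicator {\<omega> \<in> space M. Suc n \<le> N t \<omega>} \<omega> \<partial>M)"
  proof (rule nn_integral_cong)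
    fix \<omega> assume \<omega>: "\<omega> \<in> space M"
    define J where "J = jump_times (\<lambda>t. N t \<omega>)"
    define S where "S = {s \<in> J. s \<le> t \<and> left_lim (\<lambda>u. N u \<omega>) s = n}"
    have "(\<integral>\<^sup>+ s. C (s, \<omega>) \<partial>count_space J) = (\<integral>\<^sup>+ s. indicator S s \<partial>count_space J)"
      by (intro nn_integral_cong)
        (auto simp: C_def S_def J_def jump_times_def indicator_def B_iff[OF \<omega>])
    also have "\<dots> = emeasure (count_space J) S"
      by (intro nn_integral_indicator) (auto simp: S_def)
    also have "\<dots> = indicator {\<omega> \<in> space M. Suc n \<le> N t \<omega>} \<omega>"
      unfolding S_def J_def emeasure_jumps_from_level[OF path[OF \<omega>] t]
      using \<omega> by (auto simp: indicator_def)
    finally show "(\<integral>\<^sup>+ s. C (s, \<omega>) \<partial>count_space (jump_times (\<lambda>t. N t \<omega>))) =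
        indicator {\<omega> \<in> space M. Suc n \<le> N t \<omega>} \<omega>"
      by (simp add: J_def)
  qed
  also have "\<dots> = ennreal (tail (Suc n) t)"
    using sets_level[OF t] by (simp add: tail_def emeasure_eq_measure)
  finally have "ennreal (tail (Suc n) t) = (\<integral>\<^sup>+ \<omega>. (\<integral>\<^sup>+ s\<in>{0<..}. C (s, \<omega>) *
      ennreal (lam ((real (left_lim (\<lambda>s. N s \<omega>) s) + \<gamma>) / (s + 1))) \<partial>lborel) \<partial>M)"
    using nn_integral_intensity[of C] B_pred by (simp add: C_def)
  \<comment> \<open>Cutting the rate off to \<open>{0..}\<close>, where it is continuous, makes it
    Borel on the whole line.\<close>
  also have "\<dots> = (\<integral>\<^sup>+ \<omega>. (\<integral>\<^sup>+ s. indicator B (s, \<omega>) *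
      ennreal (indicator {0..} s *\<^sub>R level_rate n s) \<partial>lborel) \<partial>M)"
    by (intro nn_integral_cong)
      (auto simp: C_def indicator_def B_iff level_rate_def)
  also have "\<dots> = (\<integral>\<^sup>+ s. (\<integral>\<^sup>+ \<omega>. indicator B (s, \<omega>) *
      ennreal (indicator {0..} s *\<^sub>R level_rate n s) \<partial>M) \<partial>lborel)"
  proof -
    interpret pair_sigma_finite lborel M ..
    have [measurable]: "(\<lambda>s. indicator {0..} s *\<^sub>R level_rate n s) \<in> borel_measurable borel"
      by (intro borel_measurable_continuous_on_indicator level_rate_cont) auto
    note B_prod [measurable]
    show ?thesis
      by (intro Fubini') measurable
  qed
  also have "\<dots> = (\<integral>\<^sup>+ s. ennreal (level_rate n s * (left_tail n s - left_tail (Suc n) s)) *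
      indicator {0<..t} s \<partial>lborel)"
  proof (rule nn_integral_cong)
    fix s :: real
    let ?L = "\<lambda>k. {\<omega> \<in> space M. k \<le> left_lim (\<lambda>u. N u \<omega>) s}"
    show "(\<integral>\<^sup>+ \<omega>. indicator B (s, \<omega>) * ennreal (indicator {0..} s *\<^sub>R level_rate n s) \<partial>M) =
        ennreal (level_rate n s * (left_tail n s - left_tail (Suc n) s)) * indicator {0<..t} s"
    proof (cases "0 < s \<and> s \<le> t")
      case True
      then have sets: "?L k \<in> sets M" for k
        by (intro sets_left_level) simp
      have "(\<integral>\<^sup>+ \<omega>. indicator B (s, \<omega>) * ennreal (indicator {0..} s *\<^sub>R level_rate n s) \<partial>M) =
          (\<integral>\<^sup>+ \<omega>. ennreal (level_rate n s) * indicator (?L n - ?L (Suc n)) \<omega> \<partial>M)"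
        using True by (intro nn_integral_cong) (auto simp: indicator_def B_iff)
      also have "\<dots> = ennreal (level_rate n s) * emeasure M (?L n - ?L (Suc n))"
        using sets by (intro nn_integral_cmult_indicator) auto
      also have "emeasure M (?L n - ?L (Suc n)) = ennreal (left_tail n s - left_tail (Suc n) s)"
        unfolding left_tail_def emeasure_eq_measure
        by (subst finite_measure_Diff[OF sets sets]) auto
      finally show ?thesis
        using True level_rate_pos[of s n] by (simp add: ennreal_mult')
    next
      case False
      then have "indicator B (s, \<omega>) = (0::ennreal)" for \<omega>
        by (auto simp: B_def indicator_def)
      then show ?thesis
        using False by (auto simp: indicator_def)
    qed
  qed
  finally show ?thesis .
qed

section \<open>Continuity of the tails and their differential equations\<close>

lemma left_tail_nonneg: "0 \<le> left_tail k s"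
  by (simp add: left_tail_def)

lemma left_tail_le_1: "left_tail k s \<le> 1"
  by (simp add: left_tail_def)

lemma left_tail_Suc_le: "0 < s \<Longrightarrow> left_tail (Suc k) s \<le> left_tail k s"
  unfolding left_tail_def by (intro finite_measure_mono sets_left_level) auto

lemma tail_mono:
  assumes "0 \<le> s" "s \<le> s'"
  shows "tail k s \<le> tail k s'"
  unfolding tail_def
proof (intro finite_measure_mono sets_level)
  have "N s \<omega> \<le> N s' \<omega>" if "\<omega> \<in> space M" for \<omega>
    using path[OF that] assms by (auto simp: simple_counting_path_def mono_on_def)
  then show "{\<omega> \<in> space M. k \<le> N s \<omega>} \<subseteq> {\<omega> \<in> space M. k \<le> N s' \<omega>}"
    by (auto intro: order_trans)
qed (use assms in simp)

lemma left_tail_le_tail: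
  assumes "0 < s"
  shows "left_tail k s \<le> tail k s"
  unfolding left_tail_def tail_def using left_lim_le[OF path assms] assms
  by (intro finite_measure_mono sets_level) (auto intro: order_trans)

lemma tail_le_left_tail:
  assumes "0 \<le> q" "q < s"
  shows "tail k q \<le> left_tail k s"
  unfolding left_tail_def tail_def using le_left_lim[OF path assms] assms
  by (intro finite_measure_mono sets_left_level) (auto intro: order_trans)

text \<open>Continuity of \<open>tail\<close> has to come first: it is what identifies \<open>left_tail\<close> with \<open>tail\<close>, and so
  turns the integral equation above into a closed system.\<close>

lemma tail_Lipschitz:
  assumes "0 \<le> u" "u \<le> v"
  shows "tail (Suc n) v \<le> tail (Suc n) u + level_rate n 0 * (v - u)"
proof -
  let ?h = "\<lambda>s. ennreal (level_rate n s * (left_tail n s - left_tail (Suc n) s))"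
  let ?c = "level_rate n 0"
  have c: "0 \<le> ?c"
    using level_rate_pos[of 0 n] by simp
  have "ennreal (tail (Suc n) v) = (\<integral>\<^sup>+ s. ?h s * indicator {0<..v} s \<partial>lborel)"
    using assms by (intro ennreal_tail_Suc) simp
  also have "\<dots> \<le> (\<integral>\<^sup>+ s. ?h s * indicator {0<..u} s + ennreal ?c * indicator {u<..v} s \<partial>lborel)"
  proof (rule nn_integral_mono)
    fix s :: real
    \<comment> \<open>The rate is largest at time \<open>0\<close>, and consecutive left tails
      differ by a number in \<open>[0, 1]\<close>.\<close>
    have "?h s \<le> ennreal ?c" if "0 < s"
    proof (rule ennreal_leI)
      have "level_rate n s * (left_tail n s - left_tail (Suc n) s) \<le> ?c * 1"
        using that level_rate_le[of s n] c left_tail_le_1[of n s] left_tail_nonneg[of "Suc n" s]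
          left_tail_Suc_le[of s n]
        by (intro mult_mono) auto
      then show "level_rate n s * (left_tail n s - left_tail (Suc n) s) \<le> ?c"
        by simp
    qed
    then show "?h s * indicator {0<..v} s \<le>
        ?h s * indicator {0<..u} s + ennreal ?c * indicator {u<..v} s"
      using assms by (auto simp: indicator_def)
  qed
  also have "\<dots> = ennreal (tail (Suc n) u) + (\<integral>\<^sup>+ s. ennreal ?c * indicator {u<..v} s \<partial>lborel)"
  proof (subst nn_integral_add)
    have [measurable]: "(\<lambda>s. indicator {0..} s *\<^sub>R level_rate n s) \<in> borel_measurable borel"
      by (intro borel_measurable_continuous_on_indicator level_rate_cont) auto
    have [measurable]: "(\<lambda>s. emeasure M (Pair s -` reached_before k)) \<in> borel_measurable borel" for k
      using measurable_emeasure_Pair[OF sets_reached_before, of k] by simp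
    \<comment> \<open>Measurability in \<open>s\<close> comes from the sections of
      \<open>reached_before\<close>; this expression agrees with the integrand on
      \<open>{0<..u}\<close>, and both vanish outside.\<close>
    have "(\<lambda>s. ennreal ((indicator {0..} s *\<^sub>R level_rate n s) *
        (enn2real (emeasure M (Pair s -` reached_before n)) -
         enn2real (emeasure M (Pair s -` reached_before (Suc n))))) * indicator {0<..u} s)
        \<in> borel_measurable borel"
      by measurable
    also have "(\<lambda>s. ennreal ((indicator {0..} s *\<^sub>R level_rate n s) *
        (enn2real (emeasure M (Pair s -` reached_before n)) -
         enn2real (emeasure M (Pair s -` reached_before (Suc n))))) * indicator {0<..u} s) =
        (\<lambda>s. ?h s * indicator {0<..u} s)"
      by (auto simp: fun_eq_iff indicator_def reached_before_section left_tail_def measure_def)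
    finally show "(\<lambda>s. ?h s * indicator {0<..u} s) \<in> borel_measurable lborel"
      by simp
  qed (use assms in \<open>auto simp: ennreal_tail_Suc\<close>)
  also have "(\<integral>\<^sup>+ s. ennreal ?c * indicator {u<..v} s \<partial>lborel) = ennreal (?c * (v - u))"
    using assms c by (simp add: nn_integral_cmult_indicator ennreal_mult')
  also have "ennreal (tail (Suc n) u) + ennreal (?c * (v - u)) =
      ennreal (tail (Suc n) u + ?c * (v - u))"
    using assms c by (intro ennreal_plus[symmetric]) (auto simp: tail_def)
  finally show ?thesis
    using assms c by (subst (asm) ennreal_le_iff) (auto simp: tail_def)
qed

lemma tail_0: "tail 0 s = 1"
  by (simp add: tail_def prob_space)

lemma continuous_on_tail: "continuous_on {0..} (tail k)"
proof (cases k)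
  case 0
  then have "tail k = (\<lambda>_. 1)"
    by (simp add: fun_eq_iff tail_0)
  then show ?thesis
    by simp
next
  case (Suc n)
  have c: "0 \<le> level_rate n 0"
    using level_rate_pos[of 0 n] by simp
  have *: "\<bar>tail k u - tail k v\<bar> \<le> level_rate n 0 * \<bar>u - v\<bar>" if "0 \<le> u" "u \<le> v" for u v
    using tail_Lipschitz[OF that, of n] tail_mono[OF that, of k] that by (simp add: Suc)
  have "\<bar>tail k u - tail k v\<bar> \<le> level_rate n 0 * \<bar>u - v\<bar>" if "0 \<le> u" "0 \<le> v" for u v
    using *[of u v] *[of v u] that by (cases "u \<le> v") (auto simp: abs_minus_commute)
  then have "(level_rate n 0)-lipschitz_on {0..} (tail k)"
    using c by (intro lipschitz_onI) (auto simp: dist_real_def)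
  then show ?thesis
    by (rule lipschitz_on_continuous_on)
qed

text \<open>For \<open>0 \<le> q < s\<close>,
  \<open>tail k q \<le> left_tail k s \<le> tail k s\<close>, and continuity of \<open>tail\<close>
  closes the gap as \<open>q\<close> tends to \<open>s\<close>. Thus no fixed time carries a jump
  with positive probability.\<close>

lemma left_tail_eq_tail:
  assumes s: "0 < s"
  shows "left_tail k s = tail k s"
proof (rule antisym[OF left_tail_le_tail[OF s]])
  have "(tail k \<longlongrightarrow> tail k s) (at s within {0..})"
    using continuous_on_tail s by (auto simp: continuous_on_def)
  also have "at s within {0..} = at s"
    by (rule at_within_nhd[where S = "{0<..}"]) (use s in auto)
  finally have "(tail k \<longlongrightarrow> tail k s) (at_left s)"
    by (simp add: filterlim_at_split)
  moreover have "eventually (\<lambda>q. q \<in> {0<..<s}) (at_left s)"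
    using s by (rule eventually_at_left_real)
  then have "eventually (\<lambda>q. tail k q \<le> left_tail k s) (at_left s)"
    by eventually_elim (auto intro: tail_le_left_tail)
  ultimately show "tail k s \<le> left_tail k s"
    by (intro tendsto_upperbound) (auto simp: trivial_limit_at_left_real)
qed

lemma tail_Suc_eq_integral:
  assumes t: "0 \<le> t"
  shows "tail (Suc n) t = integral {0..t} (\<lambda>s. level_rate n s * (tail n s - tail (Suc n) s))"
proof -
  let ?h = "\<lambda>s. level_rate n s * (tail n s - tail (Suc n) s)"
  have "continuous_on {0..t} ?h"
    by (intro continuous_intros continuous_on_subset[OF level_rate_cont]
        continuous_on_subset[OF continuous_on_tail]) auto
  then have int: "(?h has_integral integral {0..t} ?h) {0..t}"
    by (intro integrable_integral integrable_continuous_real)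
  have "tail (Suc n) s \<le> tail n s" if "0 \<le> s" for s
    unfolding tail_def using that by (intro finite_measure_mono sets_level) auto
  then have nonneg: "0 \<le> ?h s" if "s \<in> {0..t}" for s
    using that level_rate_pos[of s n] by (intro mult_nonneg_nonneg) auto
  have "ennreal (tail (Suc n) t) = (\<integral>\<^sup>+ s. ennreal (?h s) * indicator {0<..t} s \<partial>lborel)"
    unfolding ennreal_tail_Suc[OF t]
    by (intro nn_integral_cong) (auto simp: indicator_def left_tail_eq_tail)
  also have "\<dots> = (\<integral>\<^sup>+ s. ennreal (?h s) * indicator {0..t} s \<partial>lborel)"
  proof (rule nn_integral_cong_AE)
    have "AE s in lborel. s \<noteq> (0::real)"
      by (rule AE_lborel_singleton)
    then show "AE s in lborel. ennreal (?h s) * indicator {0<..t} s = ennreal (?h s) * indicator {0..t} s"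
      by eventually_elim (auto simp: indicator_def)
  qed
  also have "\<dots> = ennreal (integral {0..t} ?h)"
    by (rule nn_integral_has_integral_lebesgue'[OF nonneg int])
  finally show ?thesis
    using has_integral_nonneg[OF int nonneg] by (simp add: tail_def)
qed

lemma tail_deriv:
  assumes s: "0 \<le> s"
  shows "(tail (Suc n) has_real_derivative level_rate n s * (tail n s - tail (Suc n) s))
    (at s within {0..})"
proof -
  let ?h = "\<lambda>s. level_rate n s * (tail n s - tail (Suc n) s)"
  \<comment> \<open>The upper end \<open>s + 1\<close> makes the interval a neighbourhood of
    \<open>s\<close> relative to \<open>{0..}\<close>.\<close>
  have "continuous_on {0..s + 1} ?h"
    by (intro continuous_intros continuous_on_subset[OF level_rate_cont]
        continuous_on_subset[OF continuous_on_tail]) auto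
  then have "((\<lambda>x. integral {0..x} ?h) has_real_derivative ?h s) (at s within {0..s + 1})"
    using s by (intro integral_has_real_derivative) auto
  then have "(tail (Suc n) has_real_derivative ?h s) (at s within {0..s + 1})"
    by (rule has_field_derivative_transform_within[where d = 1])
      (use s in \<open>auto simp: tail_Suc_eq_integral\<close>)
  moreover have "at s within {0..} = at s within {0..s + 1}"
    by (rule at_within_nhd[where S = "{..<s + 1}"]) auto
  ultimately show ?thesis
    by simp
qed

sublocale birth_tails tail level_rate
proof
  fix n s
  show "tail 0 s = 1"
    by (rule tail_0)
  have "{\<omega> \<in> space M. Suc n \<le> N 0 \<omega>} = {}"
    using path by (fastforce simp: simple_counting_path_def)
  then show "tail (Suc n) 0 = 0"
    unfolding tail_def by (simp only: measure_empty)
qed (simp_all add: tail_mono level_rate_pos level_rate_cont tail_deriv, simp_all add: tail_def)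

end

subsection \<open>Exponential decay rate\<close>

context self_exciting
begin

text \<open>A slope \<open>b\<close> between \<alpha> and \<open>a\<close> leaves the slack
  \<open>(a - b) * n\<close>, which absorbs \<open>b * \<gamma>\<close> for large \<open>n\<close>;
  as \<open>s\<close> stays below \<open>t\<close>, the argument of \<open>lam\<close> is large
  uniformly in \<open>s\<close>.\<close>

lemma level_rate_upper:
  assumes lim: "((\<lambda>z. lam z / z) \<longlongrightarrow> \<alpha>) at_top" and \<alpha>: "0 < \<alpha>" and a: "\<alpha> < a" and t: "0 < t"
  obtains n0 where "\<And>n s. n0 \<le> n \<Longrightarrow> 0 \<le> s \<Longrightarrow> s \<le> t \<Longrightarrow>
    level_rate n s \<le> a * (real n + 1) / (s + 1)"
proof -
  obtain b where b: "\<alpha> < b" "b < a"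
    using dense a by blast
  have "eventually (\<lambda>z. lam z / z < b \<and> 0 < z) at_top"
    using order_tendstoD(2)[OF lim b(1)] by (intro eventually_conj eventually_gt_at_top)
  then obtain z0 where z0: "lam z / z < b" "0 < z" if "z0 \<le> z" for z
    unfolding eventually_at_top_linorder by blast
  have z0_pos: "0 < z0"
    using z0(2) by simp
  \<comment> \<open>For \<open>n \<ge> n0\<close>, the first summand puts
    \<open>(n + \<gamma>) / (s + 1)\<close> beyond \<open>z0\<close> for all
    \<open>s \<le> t\<close>, the second gives
    \<open>b * \<gamma> \<le> (a - b) * n\<close>.\<close>
  obtain n0 where n0: "z0 * (t + 1) + b * \<gamma> / (a - b) \<le> real n0"
    using real_arch_simple by blast
  have terms: "0 \<le> z0 * (t + 1)" "0 \<le> b * \<gamma> / (a - b)"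
    using z0_pos t b \<alpha> gamma_pos by auto
  show thesis
  proof (rule that[of n0])
    fix n s assume n: "n0 \<le> n" and s: "0 \<le> s" "s \<le> t"
    define z where "z = (real n + \<gamma>) / (s + 1)"
    have "z0 * (s + 1) \<le> z0 * (t + 1)"
      using s z0_pos by simp
    also have "\<dots> \<le> real n + \<gamma>"
      using n0 n terms gamma_pos by linarith
    finally have "z0 \<le> z"
      using s by (simp add: z_def le_divide_eq)
    then have "lam z \<le> b * z"
      using z0[of z] by (simp add: divide_less_eq)
    also have "\<dots> = b * (real n + \<gamma>) / (s + 1)"
      by (simp add: z_def)
    also have "\<dots> \<le> a * (real n + 1) / (s + 1)"
    proof (rule divide_right_mono)
      have "b * \<gamma> / (a - b) \<le> real n"
        using n0 n terms by linarith
      then have "b * \<gamma> \<le> (a - b) * real n"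
        using b by (simp add: divide_le_eq mult.commute)
      then show "b * (real n + \<gamma>) \<le> a * (real n + 1)"
        using b \<alpha> by (simp add: algebra_simps)
    qed (use s in simp)
    finally show "level_rate n s \<le> a * (real n + 1) / (s + 1)"
      by (simp add: level_rate_def z_def)
  qed
qed

text \<open>The rate at level \<open>n0 + k\<close> only has to beat the Yule rate at level
  \<open>k\<close>, so \<open>n0 \<ge> 1\<close> takes the place of an intermediate slope.\<close>

lemma level_rate_lower:
  assumes lim: "((\<lambda>z. lam z / z) \<longlongrightarrow> \<alpha>) at_top" and a: "0 < a" "a < \<alpha>" and t: "0 < t"
  obtains n0 where "\<And>k s. 0 \<le> s \<Longrightarrow> s \<le> t \<Longrightarrow>
    a * (real k + 1) / (s + 1) \<le> level_rate (n0 + k) s"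
proof -
  have "eventually (\<lambda>z. a < lam z / z \<and> 0 < z) at_top"
    using order_tendstoD(1)[OF lim a(2)] by (intro eventually_conj eventually_gt_at_top)
  then obtain z0 where z0: "a < lam z / z" "0 < z" if "z0 \<le> z" for z
    unfolding eventually_at_top_linorder by blast
  have z0_pos: "0 < z0"
    using z0(2) by simp
  obtain n0 where n0: "z0 * (t + 1) + 1 \<le> real n0"
    using real_arch_simple by blast
  have nonneg: "0 \<le> z0 * (t + 1)"
    using z0_pos t by simp
  show thesis
  proof (rule that[of n0])
    fix k s assume s: "0 \<le> s" "s \<le> t"
    define z where "z = (real (n0 + k) + \<gamma>) / (s + 1)"
    have "z0 * (s + 1) \<le> z0 * (t + 1)"
      using s z0_pos by simp
    also have "\<dots> \<le> real (n0 + k) + \<gamma>"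
      using n0 gamma_pos by simp
    finally have z: "z0 \<le> z"
      using s by (simp add: z_def le_divide_eq)
    have "a * (real k + 1) / (s + 1) \<le> a * (real (n0 + k) + \<gamma>) / (s + 1)"
      using s a n0 nonneg gamma_pos by (intro divide_right_mono mult_left_mono) auto
    also have "\<dots> = a * z"
      by (simp add: z_def)
    also have "\<dots> \<le> lam z"
      using z0[OF z] by (simp add: less_divide_eq)
    finally show "a * (real k + 1) / (s + 1) \<le> level_rate (n0 + k) s"
      by (simp add: level_rate_def z_def)
  qed
qed

text \<open>Logarithm of \<open>Q_upper\<close>: the factor \<open>\<eta> ^ n0\<close> contributes a
  constant that disappears after division by \<open>l\<close>.\<close>

lemma log_tail_upper:
  assumes lim: "((\<lambda>z. lam z / z) \<longlongrightarrow> \<alpha>) at_top" and \<alpha>: "0 < \<alpha>" "\<alpha> < a" and t: "0 < t"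
    and eta: "0 < \<eta>" "\<eta> < 1"
    and u: "ln (1 - (1 - \<eta>) * (t + 1) powr (- a)) < u"
  shows "eventually (\<lambda>l. 1 / l * ln (tail (nat \<lceil>l\<rceil>) t) < u) at_top"
proof -
  define x where "x = 1 - (1 - \<eta>) * (t + 1) powr (- a)"
  obtain n0 where n0: "\<And>n s. n0 \<le> n \<Longrightarrow> 0 \<le> s \<Longrightarrow> s \<le> t \<Longrightarrow>
      level_rate n s \<le> a * (real n + 1) / (s + 1)"
    using level_rate_upper[OF lim \<alpha> t] by blast
  have "(t + 1) powr (- a) \<le> 1"
    using t \<alpha> powr_mono[of "- a" 0 "t + 1"] by simp
  then have "(1 - \<eta>) * (t + 1) powr (- a) \<le> 1 - \<eta>"
    using eta by (intro mult_left_le) auto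
  then have "\<eta> \<le> x"
    by (simp add: x_def)
  then have x: "0 < x" "x \<le> 1"
    using eta by (simp_all add: x_def)
  define c where "c = real n0 * ln \<eta>"
  have bound: "1 / l * ln (tail (nat \<lceil>l\<rceil>) t) \<le> ln x - c / l" if l: "0 < l" "real n0 \<le> l" for l
  proof -
    define n where "n = nat \<lceil>l\<rceil>"
    have n: "l \<le> real n" "n0 \<le> n"
      using l by (auto simp: n_def) linarith+
    have "tail n t \<le> x ^ n / \<eta> ^ n0"
      unfolding x_def by (rule Q_upper[where T = t]) (use \<alpha> eta t n n0 in auto)
    then have "ln (tail n t) \<le> ln (x ^ n / \<eta> ^ n0)"
      using Q_pos[OF t, of n] by simp
    also have "\<dots> = real n * ln x - c"
      using x eta by (simp add: ln_div ln_realpow c_def)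
    \<comment> \<open>Since \<open>ln x \<le> 0\<close>, rounding \<open>l\<close> up can only
      decrease the term.\<close>
    also have "\<dots> \<le> l * ln x - c"
      using n x by (simp add: mult_right_mono_neg)
    finally show ?thesis
      using l by (simp add: n_def field_simps)
  qed
  have "((\<lambda>l. ln x - c / l) \<longlongrightarrow> ln x - 0) at_top"
    by (intro tendsto_diff tendsto_const tendsto_divide_0[OF tendsto_const]
        filterlim_at_top_imp_at_infinity filterlim_ident)
  then have "eventually (\<lambda>l. ln x - c / l < u) at_top"
    by (rule order_tendstoD) (use u in \<open>simp add: x_def\<close>)
  moreover have "eventually (\<lambda>l. 0 < l \<and> real n0 \<le> l) at_top"
    by (intro eventually_conj eventually_gt_at_top eventually_ge_at_top)
  ultimately show ?thesis
    by eventually_elim (use bound in force)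
qed

text \<open>Logarithm of \<open>Q_lower\<close>: the positive mass at level \<open>n0\<close> and
  time \<open>d\<close> contributes only a constant.\<close>

lemma log_tail_lower:
  assumes lim: "((\<lambda>z. lam z / z) \<longlongrightarrow> \<alpha>) at_top" and a: "0 < a" "a < \<alpha>" and d: "0 < d" "d < t"
    and u: "u < ln (1 - ((d + 1) / (t + 1)) powr a)"
  shows "eventually (\<lambda>l. u < 1 / l * ln (tail (nat \<lceil>l\<rceil>) t)) at_top"
proof -
  have t: "0 < t"
    using d by simp
  define y where "y = 1 - ((d + 1) / (t + 1)) powr a"
  obtain n0 where n0: "\<And>k s. 0 \<le> s \<Longrightarrow> s \<le> t \<Longrightarrow>
      a * (real k + 1) / (s + 1) \<le> level_rate (n0 + k) s"
    using level_rate_lower[OF lim a t] by blast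
  have "((d + 1) / (t + 1)) powr a < 1 powr a"
    using a d by (intro powr_less_mono2) auto
  then have y: "0 < y" "y \<le> 1"
    by (auto simp: y_def)
  define q where "q = tail n0 d"
  have q: "0 < q"
    unfolding q_def using d by (intro Q_pos) simp
  \<comment> \<open>The summand \<open>ln y \<le> 0\<close> pays for rounding \<open>l\<close> up,
    by at most \<open>1\<close>.\<close>
  define c where "c = ln q + ln y"
  have bound: "ln y + c / l \<le> 1 / l * ln (tail (nat \<lceil>l\<rceil>) t)" if l: "0 < l" "real n0 \<le> l" for l
  proof -
    define n where "n = nat \<lceil>l\<rceil>"
    have n: "real n \<le> l + 1" "n0 \<le> n"
      using l by (auto simp: n_def) linarith+
    have "q * y ^ n \<le> q * y ^ (n - n0)"
      using q y by (intro mult_left_mono power_decreasing) auto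
    also have "\<dots> \<le> tail (n0 + (n - n0)) t"
      unfolding y_def q_def by (rule Q_lower[where T = t]) (use a d n0 in auto)
    finally have "q * y ^ n \<le> tail n t"
      using n by simp
    then have "ln (q * y ^ n) \<le> ln (tail n t)"
      using q y Q_pos[OF t, of n] by simp
    moreover have "ln (q * y ^ n) = ln q + real n * ln y"
      using q y by (simp add: ln_mult ln_realpow)
    moreover have "(l + 1) * ln y \<le> real n * ln y"
      using n y by (simp add: mult_right_mono_neg)
    ultimately have "l * ln y + c \<le> ln (tail n t)"
      by (simp add: c_def algebra_simps)
    then have "(l * ln y + c) / l \<le> ln (tail n t) / l"
      using l by (intro divide_right_mono) auto
    then show ?thesis
      using l by (simp add: n_def add_divide_distrib)
  qed
  have "((\<lambda>l. ln y + c / l) \<longlongrightarrow> ln y + 0) at_top"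
    by (intro tendsto_add tendsto_const tendsto_divide_0[OF tendsto_const]
        filterlim_at_top_imp_at_infinity filterlim_ident)
  then have "eventually (\<lambda>l. u < ln y + c / l) at_top"
    by (rule order_tendstoD) (use u in \<open>simp add: y_def\<close>)
  moreover have "eventually (\<lambda>l. 0 < l \<and> real n0 \<le> l) at_top"
    by (intro eventually_conj eventually_gt_at_top eventually_ge_at_top)
  ultimately show ?thesis
    by eventually_elim (use bound in force)
qed

text \<open>One parameter \<open>e\<close> drives both choices in each bound: slope
  \<open>\<alpha> + e\<close> with \<open>\<eta> = e\<close> above, slope
  \<open>\<alpha> - e\<close> with \<open>d = e\<close> below. By continuity the perturbed rates
  tend to the limit as \<open>e\<close> decreases to \<open>0\<close>, so some small
  \<open>e\<close> serves any given \<open>u\<close>.\<close>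

lemma log_tail_tendsto:
  assumes lim: "((\<lambda>z. lam z / z) \<longlongrightarrow> \<alpha>) at_top" and \<alpha>: "0 < \<alpha>" and t: "0 < t"
  shows "((\<lambda>l. 1 / l * ln (tail (nat \<lceil>l\<rceil>) t)) \<longlongrightarrow> ln (1 - 1 / (t + 1) powr \<alpha>)) at_top"
proof (rule order_tendstoI)
  have "(t + 1) powr \<alpha> > 1"
    using t \<alpha> by (intro gr_one_powr) auto
  \<comment> \<open>Continuity of \<open>ln\<close> at the limit needs a nonzero argument
    there.\<close>
  then have pos: "1 - 1 / (t + 1) powr \<alpha> \<noteq> 0"
    by simp
  {
    fix u assume u: "ln (1 - 1 / (t + 1) powr \<alpha>) < u"
    have "((\<lambda>e. ln (1 - (1 - e) * (t + 1) powr (- (\<alpha> + e)))) \<longlongrightarrow>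
        ln (1 - (1 - 0) * (t + 1) powr (- (\<alpha> + 0)))) (at_right 0)"
      using t pos by (intro tendsto_intros) (auto simp: powr_minus_divide)
    then have "eventually (\<lambda>e. ln (1 - (1 - e) * (t + 1) powr (- (\<alpha> + e))) < u) (at_right 0)"
      by (rule order_tendstoD) (use u in \<open>simp add: powr_minus_divide\<close>)
    moreover have "eventually (\<lambda>e. e \<in> {0<..<1}) (at_right (0::real))"
      by (rule eventually_at_right_real) simp
    ultimately have "eventually (\<lambda>e. ln (1 - (1 - e) * (t + 1) powr (- (\<alpha> + e))) < u \<and>
        e \<in> {0<..<1}) (at_right 0)"
      by (rule eventually_conj)
    then obtain e where "ln (1 - (1 - e) * (t + 1) powr (- (\<alpha> + e))) < u" "0 < e" "e < 1"
      using eventually_happens'[OF trivial_limit_at_right_real] by fastforce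
    then show "eventually (\<lambda>l. 1 / l * ln (tail (nat \<lceil>l\<rceil>) t) < u) at_top"
      using \<alpha> t by (intro log_tail_upper[OF lim, where a = "\<alpha> + e" and \<eta> = e]) auto
  next
    fix u assume u: "u < ln (1 - 1 / (t + 1) powr \<alpha>)"
    have "((\<lambda>e. ln (1 - ((e + 1) / (t + 1)) powr (\<alpha> - e))) \<longlongrightarrow>
        ln (1 - ((0 + 1) / (t + 1)) powr (\<alpha> - 0))) (at_right 0)"
      using t pos by (intro tendsto_intros) (auto simp: powr_divide)
    then have "eventually (\<lambda>e. u < ln (1 - ((e + 1) / (t + 1)) powr (\<alpha> - e))) (at_right 0)"
      by (rule order_tendstoD) (use u t in \<open>simp add: powr_divide\<close>)
    \<comment> \<open>\<open>e < \<alpha>\<close> keeps the slope positive, \<open>e < t\<close>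
      keeps the starting time below \<open>t\<close>.\<close>
    moreover have "eventually (\<lambda>e. e \<in> {0<..<min \<alpha> t}) (at_right (0::real))"
      using \<alpha> t by (intro eventually_at_right_real) simp
    ultimately have "eventually (\<lambda>e. u < ln (1 - ((e + 1) / (t + 1)) powr (\<alpha> - e)) \<and>
        e \<in> {0<..<min \<alpha> t}) (at_right 0)"
      by (rule eventually_conj)
    then obtain e where "u < ln (1 - ((e + 1) / (t + 1)) powr (\<alpha> - e))" "0 < e" "e < min \<alpha> t"
      using eventually_happens'[OF trivial_limit_at_right_real] by fastforce
    then show "eventually (\<lambda>l. u < 1 / l * ln (tail (nat \<lceil>l\<rceil>) t)) at_top"
      by (intro log_tail_lower[OF lim, where a = "\<alpha> - e" and d = e]) auto
  }
qed

end

theorem theorem26: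
  fixes M :: "'a measure"
    and N :: "real \<Rightarrow> 'a \<Rightarrow> nat"
    and lam :: "real \<Rightarrow> real"
    and \<gamma> \<alpha> t :: real
  assumes "\<gamma> > 0"
    and "admissible_rate lam"
    and "self_exciting_point_process M lam \<gamma> N"
    and "\<alpha> > 0"
    and "((\<lambda>z. lam z / z) \<longlongrightarrow> \<alpha>) at_top"
    and "t > 0"
  shows "((\<lambda>l::real. 1 / l * ln (measure M {\<omega> \<in> space M. real (N t \<omega>) \<ge> l}))
           \<longlongrightarrow> ln (1 - 1 / (t + 1) powr \<alpha>)) at_top"
proof -
  interpret self_exciting M N lam \<gamma>
    using assms(1-3) by unfold_locales
  \<comment> \<open>The real threshold is rounded up to an integer level; for
    \<open>l \<le> 0\<close> that level is \<open>0\<close> and both sides hold.\<close>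
  have "real (N t \<omega>) \<ge> l \<longleftrightarrow> nat \<lceil>l\<rceil> \<le> N t \<omega>" for l \<omega>
    by linarith
  then show ?thesis
    using log_tail_tendsto[OF assms(5,4,6)] by (simp add: tail_def)
qed

end
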